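(* Let $\alpha_0,\alpha_1,\alpha_2,\alpha_3,\alpha_4$ be complex parameters with $\alpha_0+\alpha_1+2\alpha_2+\alpha_3+\alpha_4=1$, and consider the autonomous system of ordinary differential equations in the unknowns $f_0,f_1,f_2,f_3,f_4,g_1,g_2$ $$ \begin{aligned} \frac{df_0}{dt} &=-(2f_1g_1+\alpha_1)f_0-\alpha_0f_1,\\ \frac{df_1}{dt} &=-(2f_0g_1+\alpha_0)f_1-\alpha_1f_0,\\ \frac{df_2}{dt} &=\{(f_0+f_1)g_1+(f_3+f_4)g_2+1\}f_2-2\alpha_2 g_1g_2,\\ \frac{df_3}{dt} &=-(2f_4g_2+\alpha_4)f_3-\alpha_3f_4,\\ \frac{df_4}{dt} &=-(2f_3g_2+\alpha_3)f_4-\alpha_4f_3,\\ \frac{dg_1}{dt} &=(f_0+f_1)g_1^2-\{(f_3+f_4)g_2-\alpha_0-\alpha_1\}g_1+(f_3+f_4)f_2,\\ \frac{dg_2}{dt} &=(f_3+f_4)g_2^2-\{(f_0+f_1)g_1-\alpha_3-\alpha_4\}g_2+(f_0+f_1)f_2. \end{aligned} $$ Then for each $i\in\{0,1,2,3,4\}$: if $\alpha_i=0$, the divisor $\{f_i=0\}$ is an invariant divisor of this system.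
   Context: All unknowns are complex variables and $t$ is the (complex) independent variable. A divisor $\{F=0\}$, with $F$ a polynomial in the unknowns $f_0,\dots,f_4,g_1,g_2$, is called an invariant divisor of the system if the derivative $dF/dt$ along the system (a polynomial in the unknowns) is divisible by $F$ in the polynomial ring $\mathbb{C}[f_0,\dots,f_4,g_1,g_2]$. *)

theory Defs
  imports Complex_Main "HOL-Library.Poly_Mapping"
begin

text \<open>
  Finitely supported maps from exponent vectors to coefficients, with the convolution product of
  \<open>Poly_Mapping\<close>: this type is the polynomial ring over \<open>'a\<close> with one variable for each
  element of \<open>'v\<close>, and \<open>dvd\<close> on it is divisibility in that ring.
\<close>

type_synonym ('v, 'a) mvpoly = "('v \<Rightarrow>\<^sub>0 nat) \<Rightarrow>\<^sub>0 'a"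

definition Const :: "'a :: zero \<Rightarrow> ('v, 'a) mvpoly" where
  "Const c = Poly_Mapping.single 0 c"

definition Var :: "'v \<Rightarrow> ('v, 'a :: zero_neq_one) mvpoly" where
  "Var v = Poly_Mapping.single (Poly_Mapping.single v 1) 1"

text \<open>
  The truncated subtraction of exponents is harmless: where it truncates,
  the coefficient is \<open>0\<close>.
\<close>

definition partial_deriv :: "'v \<Rightarrow> ('v, 'a :: comm_ring_1) mvpoly \<Rightarrow> ('v, 'a) mvpoly" where
  "partial_deriv v p =
     (\<Sum>m \<in> Poly_Mapping.keys p.
        Poly_Mapping.single (m - Poly_Mapping.single v 1)
          (of_nat (Poly_Mapping.lookup m v) * Poly_Mapping.lookup p m))"

text \<open>
  A polynomial autonomous system \<open>dv/dt = V v\<close> is given by its right-hand sides \<open>V\<close>. The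
  derivative of a polynomial along it comes from the chain rule.
\<close>

definition deriv_along ::
    "('v :: finite \<Rightarrow> ('v, 'a :: comm_ring_1) mvpoly) \<Rightarrow> ('v, 'a) mvpoly \<Rightarrow> ('v, 'a) mvpoly" where
  "deriv_along V F = (\<Sum>v\<in>UNIV. partial_deriv v F * V v)"

definition invariant_divisor ::
    "('v :: finite \<Rightarrow> ('v, 'a :: comm_ring_1) mvpoly) \<Rightarrow> ('v, 'a) mvpoly \<Rightarrow> bool" where
  "invariant_divisor V F \<longleftrightarrow> F dvd deriv_along V F"

datatype unknown = F0 | F1 | F2 | F3 | F4 | G1 | G2

lemma UNIV_unknown: "UNIV = {F0, F1, F2, F3, F4, G1, G2}"
  using unknown.exhaust by blast

instance unknown :: finite
  by standard (simp add: UNIV_unknown)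

text \<open>Only the indices \<open>0, \<dots>, 4\<close> are meaningful.\<close>

definition f_unknown :: "nat \<Rightarrow> unknown" where
  "f_unknown i = [F0, F1, F2, F3, F4] ! i"

fun ode_system :: "(nat \<Rightarrow> complex) \<Rightarrow> unknown \<Rightarrow> (unknown, complex) mvpoly" where
  "ode_system \<alpha> F0 =
     - (2 * Var F1 * Var G1 + Const (\<alpha> 1)) * Var F0 - Const (\<alpha> 0) * Var F1"
| "ode_system \<alpha> F1 =
     - (2 * Var F0 * Var G1 + Const (\<alpha> 0)) * Var F1 - Const (\<alpha> 1) * Var F0"
| "ode_system \<alpha> F2 =
     ((Var F0 + Var F1) * Var G1 + (Var F3 + Var F4) * Var G2 + 1) * Var F2
       - 2 * Const (\<alpha> 2) * Var G1 * Var G2"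
| "ode_system \<alpha> F3 =
     - (2 * Var F4 * Var G2 + Const (\<alpha> 4)) * Var F3 - Const (\<alpha> 3) * Var F4"
| "ode_system \<alpha> F4 =
     - (2 * Var F3 * Var G2 + Const (\<alpha> 3)) * Var F4 - Const (\<alpha> 4) * Var F3"
| "ode_system \<alpha> G1 =
     (Var F0 + Var F1) * Var G1 ^ 2
       - ((Var F3 + Var F4) * Var G2 - Const (\<alpha> 0) - Const (\<alpha> 1)) * Var G1
       + (Var F3 + Var F4) * Var F2"
| "ode_system \<alpha> G2 =
     (Var F3 + Var F4) * Var G2 ^ 2
       - ((Var F0 + Var F1) * Var G1 - Const (\<alpha> 3) - Const (\<alpha> 4)) * Var G2
       + (Var F0 + Var F1) * Var F2"

end

theory Submission
  imports Defs
begin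

text \<open>
  The derivative of a coordinate function \<open>Var v\<close> along a vector field is the component of the
  field in the direction \<open>v\<close>, so \<open>{v = 0}\<close> is invariant exactly when \<open>Var v\<close> divides the
  right-hand side of the equation for \<open>v\<close>. In the equation for each \<open>f\<^sub>i\<close>, every term has the
  factor \<open>f\<^sub>i\<close>, except a single one that carries the coefficient \<open>\<alpha>\<^sub>i\<close>; for \<open>\<alpha>\<^sub>i = 0\<close> this term
  disappears.
\<close>

lemma partial_deriv_Var:
  "partial_deriv w (Var v :: ('v, 'a :: comm_ring_1) mvpoly) = (if w = v then 1 else 0)"
  by (simp add: partial_deriv_def Var_def lookup_single when_def)

lemma deriv_along_Var: "deriv_along V (Var v) = V v"
proof -
  have "deriv_along V (Var v) = (\<Sum>w\<in>UNIV. if w = v then V w else 0)"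
    unfolding deriv_along_def by (rule sum.cong) (simp_all add: partial_deriv_Var)
  then show ?thesis
    by simp
qed

lemma invariant_divisor_Var_iff: "invariant_divisor V (Var v) \<longleftrightarrow> Var v dvd V v"
  by (simp add: invariant_divisor_def deriv_along_Var)

theorem proposition0p1:
  fixes \<alpha> :: "nat \<Rightarrow> complex" and i :: nat
  assumes "\<alpha> 0 + \<alpha> 1 + 2 * \<alpha> 2 + \<alpha> 3 + \<alpha> 4 = 1"
    and "i \<in> {0, 1, 2, 3, 4}"
    and "\<alpha> i = 0"
  shows "invariant_divisor (ode_system \<alpha>) (Var (f_unknown i))"
proof -
  have "Const (\<alpha> i) = (0 :: (unknown, complex) mvpoly)"
    using assms(3) by (simp add: Const_def)
  then have "Var (f_unknown i) dvd ode_system \<alpha> (f_unknown i)"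
    using assms(2) by (auto simp: f_unknown_def)
  then show ?thesis
    by (simp add: invariant_divisor_Var_iff)
qed

end
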